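(* Let $\Theta \subseteq \mathbb{R}^P$ be a subset with non-empty interior, let $\mathcal{H}$ be a function space, and let $\mathcal{A} \colon \mathcal{H} \to \mathbb{R}^M$ be a (possibly non-linear) operator, where $\mathcal{H}$ is equipped with the coarsest topology $\eta$ making $\mathcal{A}$ continuous with respect to the Euclidean topology of $\mathbb{R}^M$. Let $\Phi \colon \Theta \to \mathcal{H}$ be continuous from $(\Theta, \varepsilon_\Theta)$ to $(\mathcal{H}, \eta)$, where $\varepsilon_\Theta$ is the subspace topology induced by the Euclidean topology of $\mathbb{R}^P$. Assume that $\mathcal{A} \circ \Phi$ is injective. Let $\mathcal{M} := (\mathcal{A} \circ \Phi)(\Theta)$ be equipped with the topology $\varepsilon_{\mathcal{M}}$ inherited as a subspace of $\mathbb{R}^M$, and let $$\tau := \left\{ (\mathcal{A} \circ \Phi)^{-1}(\mathcal{U}) : \mathcal{U} \in \varepsilon_{\mathcal{M}} \right\}.$$ If $\tau$ is strictly coarser than $\varepsilon_\Theta$, then every regularizing operator $\mathcal{R} \colon \mathbb{R}^M \to \Theta$ is not continuous as a map from $\mathbb{R}^M$ (with the Euclidean topology) to $(\Theta, \varepsilon_\Theta)$.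
   Context: $P$ and $M$ are positive integers. In the definition of $\tau$, $(\mathcal{A} \circ \Phi)^{-1}(\mathcal{U})$ denotes the preimage of $\mathcal{U}$; thus $\tau$ is the coarsest topology on $\Theta$ making $\mathcal{A} \circ \Phi \colon \Theta \to (\mathcal{M}, \varepsilon_{\mathcal{M}})$ continuous. The space $\mathcal{H}$ is used only as a set of functions equipped with the topology $\eta$. A regularizing operator (for the problem of finding $\theta \in \Theta$ with $(\mathcal{A} \circ \Phi)(\theta) \approx g$, given $g \in \mathbb{R}^M$) is any map $\mathcal{R} \colon \mathbb{R}^M \to \Theta$ that is continuous from $\mathbb{R}^M$ with the Euclidean topology to $(\Theta, \tau)$ and that extends the left inverse of $\mathcal{A} \circ \Phi$ defined on $\mathcal{M}$, i.e. $\mathcal{R}((\mathcal{A} \circ \Phi)(\theta)) = \theta$ for all $\theta \in \Theta$. "$\tau$ is strictly coarser than $\varepsilon_\Theta$" means $\tau \subsetneq \varepsilon_\Theta$. *)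

theory Defs
  imports "HOL-Analysis.Analysis"
begin

text \<open>
  Topologies on a proper subset of a type are rendered by the library's \<^typ>\<open>'a topology\<close>, with the
  subset as \<^const>\<open>topspace\<close>. The coarsest topology on \<open>S\<close> making \<open>f\<close> continuous into \<open>T\<close> is the
  library's \<open>pullback_topology S f T\<close>; the next two facts confirm its universal property.
\<close>

lemma continuous_map_pullback_self:
  assumes "f \<in> S \<rightarrow> topspace T"
  shows "topspace (pullback_topology S f T) = S"
    and "continuous_map (pullback_topology S f T) T f"
proof -
  show "topspace (pullback_topology S f T) = S"
    using assms by (auto simp: topspace_pullback_topology)
  then show "continuous_map (pullback_topology S f T) T f"
    using assms by (auto simp: continuous_map_def openin_pullback_topology)
qed

lemma pullback_topology_coarsest:
  assumes "topspace X = S" and "continuous_map X T f"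
    and "openin (pullback_topology S f T) V"
  shows "openin X V"
proof -
  obtain U where U: "openin T U" "V = f -` U \<inter> S"
    using assms(3) by (auto simp: openin_pullback_topology)
  have "V = {x \<in> topspace X. f x \<in> U}"
    using U(2) assms(1) by auto
  then show ?thesis
    using openin_continuous_map_preimage[OF assms(2) U(1)] by simp
qed

definition strictly_coarser :: "'a topology \<Rightarrow> 'a topology \<Rightarrow> bool" where
  "strictly_coarser X Y \<longleftrightarrow> {U. openin X U} \<subset> {U. openin Y U}"

definition image_topology ::
    "'a set \<Rightarrow> ('a \<Rightarrow> 'b::topological_space) \<Rightarrow> 'a topology" where
  "image_topology \<Theta> F = pullback_topology \<Theta> F (top_of_set (F ` \<Theta>))"

lemma openin_image_topology:
  "{V. openin (image_topology \<Theta> F) V} =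
    {{\<theta> \<in> \<Theta>. F \<theta> \<in> U} | U. openin (top_of_set (F ` \<Theta>)) U}"
  by (auto simp: image_topology_def openin_pullback_topology vimage_def Collect_conj_eq Int_commute)

definition regularizing_operator ::
    "'a set \<Rightarrow> ('a \<Rightarrow> 'b::topological_space) \<Rightarrow> ('b \<Rightarrow> 'a) \<Rightarrow> bool" where
  "regularizing_operator \<Theta> F R \<longleftrightarrow>
     R \<in> UNIV \<rightarrow> \<Theta> \<and>
     continuous_map euclidean (image_topology \<Theta> F) R \<and>
     (\<forall>\<theta>\<in>\<Theta>. R (F \<theta>) = \<theta>)"

end

theory Submission
  imports Defs
begin

text \<open>Write \<open>F\<close> for \<open>A \<circ> \<Phi>\<close>. If \<open>R\<close> is
  continuous for the Euclidean topology on \<open>\<Theta>\<close>, this part is relatively open for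
  every relatively open \<open>V\<close>, so \<open>V\<close> is open in
  \<open>image_topology\<close>. That topology is then at least as fine as the Euclidean one, hence
  not strictly coarser. \<open>openin_image_topology_if_continuous_left_inverse\<close> carries the
  argument.\<close>

lemma openin_image_topology_if_continuous_left_inverse:
  fixes F :: "'a \<Rightarrow> 'b::topological_space"
  assumes R: "continuous_map euclidean X R" and inv: "\<And>\<theta>. \<theta> \<in> \<Theta> \<Longrightarrow> R (F \<theta>) = \<theta>"
    and V: "openin X V" "V \<subseteq> \<Theta>"
  shows "openin (image_topology \<Theta> F) V"
proof -
  have "open (R -` V)"
    using openin_continuous_map_preimage[OF R V(1)] by (simp add: vimage_def)
  then have "openin (top_of_set (F ` \<Theta>)) (F ` \<Theta> \<inter> R -` V)"
    by (rule openin_open_Int)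
  moreover have "V = F -` (F ` \<Theta> \<inter> R -` V) \<inter> \<Theta>"
    using V(2) inv by (auto simp: subset_iff) metis
  ultimately show ?thesis
    unfolding image_topology_def openin_pullback_topology by blast
qed

theorem lemma2p2:
  fixes \<Theta> :: "(real ^ 'p) set"
    and H :: "('x \<Rightarrow> 'y) set"
    and A :: "('x \<Rightarrow> 'y) \<Rightarrow> real ^ 'm"
    and \<Phi> :: "real ^ 'p \<Rightarrow> ('x \<Rightarrow> 'y)"
  assumes "interior \<Theta> \<noteq> {}"
    and "continuous_map (top_of_set \<Theta>) (pullback_topology H A euclidean) \<Phi>"
    and "inj_on (A \<circ> \<Phi>) \<Theta>"
    and "strictly_coarser (image_topology \<Theta> (A \<circ> \<Phi>)) (top_of_set \<Theta>)"
  shows "\<forall>R :: real ^ 'm \<Rightarrow> real ^ 'p.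
           regularizing_operator \<Theta> (A \<circ> \<Phi>) R \<longrightarrow>
           \<not> continuous_map euclidean (top_of_set \<Theta>) R"
proof (intro allI impI notI)
  fix R :: "real ^ 'm \<Rightarrow> real ^ 'p"
  assume reg: "regularizing_operator \<Theta> (A \<circ> \<Phi>) R"
    and cont: "continuous_map euclidean (top_of_set \<Theta>) R"
  \<comment> \<open>The lemma applies with \<open>X\<close> the Euclidean subspace topology:
    \<open>cont\<close> gives the continuity and \<open>reg\<close> the left-inverse identity. The
    resulting inclusion of topologies contradicts properness in
    \<open>strictly_coarser\<close>.\<close>
  have "openin (image_topology \<Theta> (A \<circ> \<Phi>)) V" if "openin (top_of_set \<Theta>) V" for V
    using reg openin_imp_subset[OF that]
    by (intro openin_image_topology_if_continuous_left_inverse[OF cont _ that])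
      (simp_all add: regularizing_operator_def)
  with assms(4) show False
    unfolding strictly_coarser_def by blast
qed

end
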